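(* Let $\zeta\in\mathbb{C}$ be an algebraic integer and let $\mathcal{O}$ be the ring of integers of $\mathbb{Q}(\zeta)$, and suppose $\mathcal{O}$ is a unique factorization domain. Let $\{x_1,\ldots,x_n\}=_{n-1}\{y_1,\ldots,y_n\}$ be an ideal $\mathcal{O}$-PTE solution. Suppose $q\in\mathcal{O}$ is a prime with $q\mid C_n$. Then the $y_i$ can be reordered so that $x_i\equiv y_i \pmod{q}$ for $i=1,\ldots,n$.
   Context: An $\mathcal{O}$-PTE solution $X=_kY$ (with $k<n$) consists of two distinct collections (multisets) $X=\{x_1,\ldots,x_n\}$, $Y=\{y_1,\ldots,y_n\}$ of elements of $\mathcal{O}$ with $\sum_i x_i^j=\sum_i y_i^j$ for $j=1,\ldots,k$; it is ideal if $k=n-1$. For an ideal solution, $\prod_{i=1}^n(z-x_i)-\prod_{i=1}^n(z-y_i)$ is a constant $C_{n,X,Y}\in\mathcal{O}$. The constant associated with the $\mathcal{O}$-PTE problem of size $n$ is $C_n:=\gcd\{C_{n,X,Y} : X=_{n-1}Y \text{ an ideal }\mathcal{O}\text{-PTE solution of size } n\}$. *)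

theory Defs
  imports "HOL-Algebra.Algebra" "HOL-Algebra.Algebraic_Closure_Type"
    "HOL-Combinatorics.Permutations"
begin

definition simple_extension :: "complex \<Rightarrow> complex set" where
  "simple_extension \<zeta> = generate_field ring_of_type_algebra {\<zeta>}"

definition integer_ring :: "complex \<Rightarrow> complex ring" where
  "integer_ring \<zeta> =
     ring_of_type_algebra\<lparr>carrier := {x \<in> simple_extension \<zeta>. algebraic_int x}\<rparr>"

text \<open>The next definitions are for subrings \<open>R\<close> of the complex numbers: only the carrier of \<open>R\<close>
  enters explicitly, and the arithmetic is that of type \<^typ>\<open>complex\<close>. The size of the solution
  is \<open>n\<close> and its degree is \<open>k\<close>.\<close>

definition pte_solution ::
  "complex ring \<Rightarrow> nat \<Rightarrow> nat \<Rightarrow> complex multiset \<Rightarrow> complex multiset \<Rightarrow> bool" where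
  "pte_solution R n k A B \<longleftrightarrow>
     k < n \<and> size A = n \<and> size B = n \<and> A \<noteq> B \<and>
     set_mset A \<subseteq> carrier R \<and> set_mset B \<subseteq> carrier R \<and>
     (\<forall>j\<in>{1..k}. (\<Sum>x\<in>#A. x ^ j) = (\<Sum>y\<in>#B. y ^ j))"

text \<open>For \<open>n = 0\<close> the truncated subtraction is harmless, since \<open>k < n\<close> is required above.\<close>

definition ideal_pte_solution ::
  "complex ring \<Rightarrow> nat \<Rightarrow> complex multiset \<Rightarrow> complex multiset \<Rightarrow> bool" where
  "ideal_pte_solution R n A B \<longleftrightarrow> pte_solution R n (n - 1) A B"

text \<open>For an ideal solution the difference of the two products is a constant polynomial,
  by Newton's identities, so the description below is proper.\<close>

definition solution_constant :: "complex multiset \<Rightarrow> complex multiset \<Rightarrow> complex" where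
  "solution_constant A B =
     (THE c. (\<Prod>x\<in>#A. [:- x, 1:]) - (\<Prod>y\<in>#B. [:- y, 1:]) = [:c:])"

text \<open>The gcd is taken in \<open>R\<close> and is an arbitrary choice among associates; it exists when \<open>R\<close> is a
  unique factorization domain. The set is infinite in general.\<close>

definition pte_constant :: "complex ring \<Rightarrow> nat \<Rightarrow> complex" where
  "pte_constant R n =
     SomeGcd R {solution_constant A B | A B. ideal_pte_solution R n A B}"

end

theory Submission
  imports Defs "HOL-Computational_Algebra.Polynomial_FPS"
begin

text \<open>By Newton's identities the difference of the two products is a constant polynomial,
  nonzero because the multisets differ, and lying in the ring of integers; so the gcd \<open>C\<^sub>n\<close> exists and
  the prime \<open>q\<close> divides the constant of the given solution. Hence the two products agree modulo
  \<open>q\<close>. Evaluating at \<open>z = x\<^sub>1\<close> shows that \<open>q\<close> divides some \<open>x\<^sub>1 - y\<^sub>j\<close>, and cancelling the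
  monic factor \<open>z - x\<^sub>1\<close> modulo \<open>q\<close> leaves a congruence of products with fewer factors.\<close>

section \<open>Newton's identities\<close>

text \<open>The logarithmic derivative of \<open>1 - x * X\<close> is minus the geometric series
  with coefficients \<open>x ^ Suc j\<close>. Multiplied out by the product, this is the generating
  function form of Newton's identities, and it follows from the product rule without any
  division.\<close>

lemma fps_deriv_prod_mset_one_minus:
  fixes A :: "'a::comm_ring_1 multiset"
  shows "fps_deriv (\<Prod>x\<in>#A. 1 - fps_const x * fps_X) =
    - (\<Prod>x\<in>#A. 1 - fps_const x * fps_X) * Abs_fps (\<lambda>j. \<Sum>x\<in>#A. x ^ Suc j)"
proof (induction A)
  case empty
  have "Abs_fps (\<lambda>j. 0) = (0 :: 'a fps)"
    by (simp add: fps_eq_iff)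
  then show ?case by simp
next
  case (add a A)
  let ?P = "\<Prod>x\<in>#A. 1 - fps_const x * fps_X"
  let ?S = "Abs_fps (\<lambda>j. \<Sum>x\<in>#A. x ^ Suc j)"
  let ?G = "Abs_fps (\<lambda>j. a ^ Suc j)"
  have geometric: "(1 - fps_const a * fps_X) * ?G = fps_const a"
  proof (rule fps_ext)
    fix k show "((1 - fps_const a * fps_X) * ?G) $ k = fps_const a $ k"
      by (cases k) (simp_all add: left_diff_distrib mult.assoc)
  qed
  have split: "Abs_fps (\<lambda>j. \<Sum>x\<in>#add_mset a A. x ^ Suc j) = ?G + ?S"
    by (simp add: fps_eq_iff)
  have "fps_deriv (\<Prod>x\<in>#add_mset a A. 1 - fps_const x * fps_X) =
      (1 - fps_const a * fps_X) * (- ?P * ?S) - fps_const a * ?P"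
    using add.IH by (simp add: algebra_simps)
  \<comment> \<open>Writing the isolated \<open>a\<close> as the new factor times its geometric
    series lets the whole product be factored out.\<close>
  also have "\<dots> = (1 - fps_const a * fps_X) * (- ?P * ?S) - ((1 - fps_const a * fps_X) * ?G) * ?P"
    by (simp only: geometric)
  also have "\<dots> = - ((1 - fps_const a * fps_X) * ?P) * (?G + ?S)"
    by (simp add: algebra_simps)
  finally show ?case 
    unfolding split by simp
qed

text \<open>Newton's recursion determines coefficient \<open>k\<close>, up to the factor
  \<open>k\<close>, from lower coefficients and the power sums of exponents \<open>1\<close> to
  \<open>k\<close>. Strong induction therefore applies.\<close>

lemma prod_mset_one_minus_nth_cong:
  fixes A B :: "'a::{idom,ring_char_0} multiset"
  assumes "\<And>j. j \<in> {1..m} \<Longrightarrow> (\<Sum>x\<in>#A. x ^ j) = (\<Sum>y\<in>#B. y ^ j)" and "k \<le> m"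
  shows "(\<Prod>x\<in>#A. 1 - fps_const x * fps_X) $ k = (\<Prod>y\<in>#B. 1 - fps_const y * fps_X) $ k"
  using assms(2)
proof (induction k rule: less_induct)
  case (less k)
  have newton: "of_nat (Suc l) * (\<Prod>x\<in>#C. 1 - fps_const x * fps_X) $ Suc l =
      - (\<Sum>i=0..l. (\<Prod>x\<in>#C. 1 - fps_const x * fps_X) $ i * (\<Sum>x\<in>#C. x ^ Suc (l - i)))"
    for C :: "'a multiset" and l
    using arg_cong[OF fps_deriv_prod_mset_one_minus[of C], of "\<lambda>f. f $ l"]
    by (simp add: fps_mult_nth sum_negf)
  show ?case
  proof (cases k)
    case 0
    have "(\<Prod>x\<in>#C. 1 - fps_const x * fps_X) $ 0 = 1" for C :: "'a multiset"
      by (induction C) simp_all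
    with 0 show ?thesis by simp
  next
    case (Suc l)
    have "(\<Sum>x\<in>#A. x ^ Suc (l - i)) = (\<Sum>x\<in>#B. x ^ Suc (l - i))" for i
      using less.prems Suc by (intro assms(1)) auto
    then have "(\<Sum>i=0..l. (\<Prod>x\<in>#A. 1 - fps_const x * fps_X) $ i * (\<Sum>x\<in>#A. x ^ Suc (l - i))) =
        (\<Sum>i=0..l. (\<Prod>x\<in>#B. 1 - fps_const x * fps_X) $ i * (\<Sum>x\<in>#B. x ^ Suc (l - i)))"
      using less Suc by (intro sum.cong refl arg_cong2[of _ _ _ _ "(*)"]) auto
    then have "of_nat (Suc l) * (\<Prod>x\<in>#A. 1 - fps_const x * fps_X) $ Suc l =
        of_nat (Suc l) * (\<Prod>x\<in>#B. 1 - fps_const x * fps_X) $ Suc l"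
      by (simp only: newton)
    \<comment> \<open>Characteristic zero makes \<open>of_nat (Suc l)\<close> nonzero, so it can be
      cancelled.\<close>
    then show ?thesis
      using Suc by (simp del: of_nat_Suc)
  qed
qed

section \<open>Products of linear factors as polynomials\<close>

lemma degree_prod_mset_linear:
  fixes A :: "'a::idom multiset"
  shows "degree (\<Prod>x\<in>#A. [:- x, 1:]) = size A"
proof (induction A)
  case (add a A)
  have "(\<Prod>x\<in>#A. [:- x, 1:]) \<noteq> 0" by (auto simp: prod_mset_zero_iff)
  with add show ?case by (simp add: degree_mult_eq del: mult_pCons_left)
qed simp

text \<open>Reversal of coefficients is multiplicative and turns \<open>z - x\<close> into
  \<open>1 - x * z\<close>, so coefficients counted from the top become those of the power series
  counted from the bottom.\<close>

lemma coeff_prod_mset_linear: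
  fixes A :: "'a::idom multiset"
  assumes "k \<le> size A"
  shows "coeff (\<Prod>x\<in>#A. [:- x, 1:]) (size A - k) = (\<Prod>x\<in>#A. 1 - fps_const x * fps_X) $ k"
proof -
  have linear: "reflect_poly [:- x, 1:] = [:1, - x:]" for x :: 'a
    by (cases "x = 0") (simp_all add: reflect_poly_pCons' monom_altdef)
  have "fps_of_poly (reflect_poly (\<Prod>x\<in>#A. [:- x, 1:])) = (\<Prod>x\<in>#A. 1 - fps_const x * fps_X)"
  proof (induction A)
    case (add a A)
    have "fps_of_poly [:1, - a:] = 1 - fps_const a * fps_X"
      by (simp add: fps_of_poly_pCons fps_of_poly_const mult.commute flip: fps_const_neg)
    with add show ?case
      by (simp add: reflect_poly_mult linear fps_of_poly_mult del: mult_pCons_left)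
  qed simp
  then have "(\<Prod>x\<in>#A. 1 - fps_const x * fps_X) $ k =
      coeff (reflect_poly (\<Prod>x\<in>#A. [:- x, 1:])) k"
    by (metis fps_of_poly_nth)
  then show ?thesis
    using assms by (simp add: coeff_reflect_poly degree_prod_mset_linear)
qed

text \<open>The roots of the product, counted with multiplicity, give back the multiset.\<close>

lemma prod_mset_linear_inject:
  fixes A B :: "'a::idom multiset"
  assumes "(\<Prod>x\<in>#A. [:- x, 1:]) = (\<Prod>y\<in>#B. [:- y, 1:])"
  shows "A = B"
proof -
  have "proots (\<Prod>x\<in>#C. [:- x, 1:]) = C" for C :: "'a multiset"
  proof (induction C)
    case (add c C)
    have "(\<Prod>x\<in>#C. [:- x, 1:]) \<noteq> 0" by (auto simp: prod_mset_zero_iff)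
    with add show ?case by (simp add: proots_mult del: mult_pCons_left)
  qed simp
  with assms show ?thesis by metis
qed

text \<open>Power sums up to \<open>n - 1\<close> fix all coefficients except the constant one,
  which lies \<open>n\<close> places below the top. This justifies the definite description in
  \<open>solution_constant\<close>.\<close>

lemma pte_solution_constant:
  assumes "ideal_pte_solution R n A B"
  shows "(\<Prod>x\<in>#A. [:- x, 1:]) - (\<Prod>y\<in>#B. [:- y, 1:]) = [:solution_constant A B:]"
    and "solution_constant A B \<noteq> 0"
proof -
  let ?P = "(\<Prod>x\<in>#A. [:- x, 1:])" and ?Q = "(\<Prod>y\<in>#B. [:- y, 1:])"
  have size: "size A = n" "size B = n" and "A \<noteq> B"
    and sums: "\<And>j. j \<in> {1..n - 1} \<Longrightarrow> (\<Sum>x\<in>#A. x ^ j) = (\<Sum>y\<in>#B. y ^ j)"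
    using assms by (auto simp: ideal_pte_solution_def pte_solution_def)
  have "coeff (?P - ?Q) (Suc m) = 0" for m
  proof (cases "Suc m \<le> n")
    case True
    then have *: "Suc m = n - (n - Suc m)" "n - Suc m \<le> n" "n - Suc m \<le> n - 1" by simp_all
    have "coeff ?P (Suc m) = (\<Prod>x\<in>#A. 1 - fps_const x * fps_X) $ (n - Suc m)"
      using coeff_prod_mset_linear[of "n - Suc m" A] size * by simp
    moreover have "coeff ?Q (Suc m) = (\<Prod>x\<in>#B. 1 - fps_const x * fps_X) $ (n - Suc m)"
      using coeff_prod_mset_linear[of "n - Suc m" B] size * by simp
    ultimately show ?thesis
      using prod_mset_one_minus_nth_cong[OF sums *(3)] by simp
  next
    case False
    then show ?thesis by (simp add: coeff_eq_0 degree_prod_mset_linear size)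
  qed
  then have "?P - ?Q = [:coeff (?P - ?Q) 0:]"
    by (simp add: poly_eq_iff coeff_pCons split: nat.split)
  then have const: "\<exists>!c. ?P - ?Q = [:c:]"
    by (metis pCons_eq_iff)
  show eq: "?P - ?Q = [:solution_constant A B:]"
    unfolding solution_constant_def by (rule theI'[OF const])
  show "solution_constant A B \<noteq> 0"
    using eq prod_mset_linear_inject[of A B] \<open>A \<noteq> B\<close> by auto
qed

section \<open>Greatest common divisors of infinite sets\<close>

lemma (in factorial_monoid) gcd_set_exists:
  assumes "S \<subseteq> carrier G" "S \<noteq> {}"
  obtains d where "d \<in> carrier G" "\<And>s. s \<in> S \<Longrightarrow> d divides s"
    "\<And>e. e \<in> carrier G \<Longrightarrow> (\<And>s. s \<in> S \<Longrightarrow> e divides s) \<Longrightarrow> e divides d"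
proof -
  \<comment> \<open>A minimal element of \<open>M\<close> for divisibility works: \<open>M\<close> is closed under gcds with elements of \<open>S\<close>.\<close>
  define M where "M = {d \<in> carrier G. \<forall>e\<in>carrier G. (\<forall>s\<in>S. e divides s) \<longrightarrow> e divides d}"
  obtain s0 where "s0 \<in> S" using assms(2) by blast
  then have "s0 \<in> M" using assms(1) by (auto simp: M_def)
  then obtain d where d: "d \<in> M"
    and min: "\<And>e. e \<in> carrier G \<Longrightarrow> properfactor G e d \<Longrightarrow> e \<notin> M"
    using wfE_min[OF division_wellfounded, of s0 M] unfolding M_def
    by (smt (verit) case_prodI mem_Collect_eq)
  have "d divides s" if "s \<in> S" for s
  proof -
    have carr: "d \<in> carrier G" "s \<in> carrier G" using d that assms(1) by (auto simp: M_def)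
    \<comment> \<open>A common divisor of \<open>S\<close> divides both \<open>d\<close> and
      \<open>s\<close>, hence their gcd. Minimality of \<open>d\<close> then forbids this gcd to be
      a proper factor of \<open>d\<close>.\<close>
    then have "somegcd G d s \<in> M"
      using d that by (auto simp: M_def intro!: gcd_divides)
    then have "d divides somegcd G d s"
      using min[of "somegcd G d s"] carr gcd_divides_l[OF carr] by (auto simp: properfactor_def)
    then show ?thesis
      using gcd_divides_r[OF carr] carr divides_trans by blast
  qed
  with d show thesis by (intro that) (auto simp: M_def)
qed

text \<open>Factoriality concerns the monoid \<open>mult_of R\<close> of nonzero elements, whereas
  \<open>SomeGcd\<close> refers to divisibility in \<open>R\<close>. A gcd found in the monoid is
  carried over to show that the choice is made from a nonempty set.\<close>

lemma (in factorial_domain) SomeGcd_divides: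
  assumes "S \<subseteq> carrier R - {\<zero>}" "s \<in> S"
  shows "SomeGcd R S \<in> carrier R" "SomeGcd R S divides s"
proof -
  obtain d where d: "d \<in> carrier (mult_of R)" "\<And>s. s \<in> S \<Longrightarrow> d divides\<^bsub>mult_of R\<^esub> s"
    "\<And>e. e \<in> carrier (mult_of R) \<Longrightarrow> (\<And>s. s \<in> S \<Longrightarrow> e divides\<^bsub>mult_of R\<^esub> s) \<Longrightarrow>
      e divides\<^bsub>mult_of R\<^esub> d"
    by (rule gcd_set_exists[of S]) (use assms in auto)
  have greatest: "e divides d" if e: "e \<in> carrier R" "\<And>s. s \<in> S \<Longrightarrow> e divides s" for e
  proof -
    have "e divides\<^bsub>mult_of R\<^esub> s" if "s \<in> S" for s
      using divides_imp_divides_mult[of e s] e that assms(1) by blast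
    \<comment> \<open>Zero divides only zero, and \<open>s\<close> is nonzero.\<close>
    moreover have "e \<noteq> \<zero>"
      using e(2)[OF assms(2)] assms by (auto simp: factor_def)
    ultimately show ?thesis
      using d(3) e(1) by simp
  qed
  have Lower: "Lower (division_rel R) S = {e \<in> carrier R. \<forall>s\<in>S. e divides s}"
    using assms(1) unfolding Lower_def by fastforce
  have "greatest (division_rel R) d (Lower (division_rel R) S)"
    unfolding greatest_def Lower
  proof (intro conjI ballI)
    show "d \<in> {e \<in> carrier R. \<forall>s\<in>S. e divides s}"
      using d(1) d(2)[THEN divides_mult_imp_divides] by simp
    show "e \<sqsubseteq>\<^bsub>division_rel R\<^esub> d" if "e \<in> {e \<in> carrier R. \<forall>s\<in>S. e divides s}" for e
      using greatest[of e] that by simp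
  qed auto
  then have "greatest (division_rel R) (SomeGcd R S) (Lower (division_rel R) S)"
    unfolding SomeGcd_def inf_def by (rule someI)
  then have "SomeGcd R S \<in> {e \<in> carrier R. \<forall>s\<in>S. e divides s}"
    unfolding Lower by (rule greatest_mem)
  then show "SomeGcd R S \<in> carrier R" "SomeGcd R S divides s"
    using assms(2) by simp_all
qed

section \<open>Congruent products of linear factors\<close>

text \<open>Congruence modulo \<open>q\<close> becomes membership in \<open>I\<close>. Since the
  arithmetic is that of the type, ordinary polynomials over \<open>'a\<close> can be used, with
  coefficients tracked in \<open>R\<close> and \<open>I\<close>.\<close>

locale prime_ideal_of_subring =
  fixes R I :: "'a::comm_ring_1 set"
  assumes one_R: "1 \<in> R"
    and minus_R: "a \<in> R \<Longrightarrow> b \<in> R \<Longrightarrow> a - b \<in> R"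
    and mult_R: "a \<in> R \<Longrightarrow> b \<in> R \<Longrightarrow> a * b \<in> R"
    and zero_I: "0 \<in> I"
    and add_I: "a \<in> I \<Longrightarrow> b \<in> I \<Longrightarrow> a + b \<in> I"
    and mult_I: "a \<in> R \<Longrightarrow> b \<in> I \<Longrightarrow> a * b \<in> I"
    and one_I: "1 \<notin> I"
    and prime_I: "a \<in> R \<Longrightarrow> b \<in> R \<Longrightarrow> a * b \<in> I \<Longrightarrow> a \<in> I \<or> b \<in> I"
begin

lemma zero_R: "0 \<in> R"
  using minus_R[OF one_R one_R] by simp

lemma uminus_I: "a \<in> I \<Longrightarrow> - a \<in> I"
  using mult_I[OF minus_R[OF zero_R one_R], of a] by simp

lemma prod_R: "(\<And>i. i \<in> S \<Longrightarrow> f i \<in> R) \<Longrightarrow> prod f S \<in> R"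
  by (induction S rule: infinite_finite_induct) (simp_all add: one_R mult_R)

lemma prime_I_prod:
  assumes "finite S" "\<And>i. i \<in> S \<Longrightarrow> f i \<in> R" "prod f S \<in> I"
  shows "\<exists>i\<in>S. f i \<in> I"
  using assms
proof (induction S rule: finite_induct)
  case empty
  then show ?case using one_I by simp
next
  case (insert s S)
  then show ?case using prime_I[of "f s" "prod f S"] prod_R[of S f] by auto
qed

lemma coeff_prod_linear_R:
  assumes "\<And>i. i \<in> S \<Longrightarrow> f i \<in> R"
  shows "coeff (\<Prod>i\<in>S. [:- f i, 1:]) k \<in> R"
  using assms
proof (induction S arbitrary: k rule: infinite_finite_induct)
  case (insert s S)
  let ?P = "\<Prod>i\<in>S. [:- f i, 1:]"
  have "coeff ([:- f s, 1:] * ?P) k = (case k of 0 \<Rightarrow> 0 | Suc l \<Rightarrow> coeff ?P l) - f s * coeff ?P k"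
    by (simp add: coeff_pCons split: nat.split)
  also have "\<dots> \<in> R"
    using insert by (intro minus_R mult_R) (auto simp: zero_R split: nat.split)
  finally show ?case using insert by simp
qed (auto simp: one_R zero_R)

lemma poly_I:
  assumes "\<And>k. coeff p k \<in> I" "a \<in> R"
  shows "poly p a \<in> I"
  using assms(1)
proof (induction p)
  case (pCons c p)
  have "c \<in> I" using pCons.prems[of 0] by simp
  moreover have "poly p a \<in> I" using pCons.prems[of "Suc _"] by (intro pCons.IH) simp
  ultimately show ?case using assms(2) by (simp add: add_I mult_I)
qed (simp add: zero_I)

text \<open>As \<open>z - a\<close> is monic, coefficient \<open>k\<close> of \<open>p\<close> is
  coefficient \<open>k + 1\<close> of the product plus \<open>a\<close> times coefficient
  \<open>k + 1\<close> of \<open>p\<close>. The induction descends from above the degree, where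
  coefficients vanish.\<close>

lemma coeff_linear_cancel_I:
  assumes "\<And>k. coeff ([:- a, 1:] * p) k \<in> I" "a \<in> R"
  shows "coeff p k \<in> I"
proof (induction "Suc (degree p) - k" arbitrary: k)
  case 0
  then show ?case by (simp add: coeff_eq_0 zero_I)
next
  case (Suc l)
  have "l = Suc (degree p) - Suc k" using Suc.hyps(2) by linarith
  then have "coeff p (Suc k) \<in> I" by (rule Suc.hyps(1))
  then have "coeff ([:- a, 1:] * p) (Suc k) + a * coeff p (Suc k) \<in> I"
    by (intro add_I mult_I assms)
  then show ?case by simp
qed

text \<open>Two separate index sets are used because deleting a matched pair \<open>s\<close>,
  \<open>t\<close> leaves different sets; hence the induction is general in
  \<open>T\<close>.\<close>

lemma prod_linear_matching:
  assumes "finite S" "finite T" "card S = card T"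
    and "\<And>i. i \<in> S \<Longrightarrow> x i \<in> R" "\<And>j. j \<in> T \<Longrightarrow> y j \<in> R"
    and "\<And>k. coeff ((\<Prod>i\<in>S. [:- x i, 1:]) - (\<Prod>j\<in>T. [:- y j, 1:])) k \<in> I"
  shows "\<exists>\<sigma>. bij_betw \<sigma> S T \<and> (\<forall>i\<in>S. x i - y (\<sigma> i) \<in> I)"
  using assms
proof (induction S arbitrary: T rule: finite_induct)
  case empty
  then show ?case by (auto simp: bij_betw_def)
next
  case (insert s S)
  let ?P = "\<lambda>S. \<Prod>i\<in>S. [:- x i, 1:]" and ?Q = "\<lambda>T. \<Prod>j\<in>T. [:- y j, 1:]"
  have xs: "x s \<in> R" using insert.prems by simp
  \<comment> \<open>The first product vanishes at \<open>x s\<close>, so only the second one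
    remains.\<close>
  have "- poly (?P (insert s S) - ?Q T) (x s) \<in> I"
    using insert.prems xs by (intro uminus_I poly_I)
  then have "(\<Prod>j\<in>T. x s - y j) \<in> I"
    using insert.hyps by (simp add: poly_prod)
  then obtain t where t: "t \<in> T" "x s - y t \<in> I"
    using prime_I_prod[of T "\<lambda>j. x s - y j"] insert.prems xs by (auto simp: minus_R)
  have P: "?P (insert s S) = [:- x s, 1:] * ?P S"
    using insert.hyps by simp
  have Q: "?Q T = [:- y t, 1:] * ?Q (T - {t})"
    using insert.prems t by (simp add: prod.remove del: mult_pCons_left)
  \<comment> \<open>Replacing the factor \<open>z - y t\<close> by \<open>z - x s\<close> costs a
    multiple of \<open>x s - y t\<close>, which has its coefficients in \<open>I\<close>.\<close>
  have eq: "[:- x s, 1:] * (?P S - ?Q (T - {t})) =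
      (?P (insert s S) - ?Q T) + smult (x s - y t) (?Q (T - {t}))"
    unfolding P Q by (simp add: algebra_simps smult_diff_left)
  have "coeff (?P S - ?Q (T - {t})) k \<in> I" for k
  proof (rule coeff_linear_cancel_I[OF _ xs])
    fix k
    have "coeff (?Q (T - {t})) k * (x s - y t) \<in> I"
      using t insert.prems by (intro mult_I coeff_prod_linear_R) auto
    then show "coeff ([:- x s, 1:] * (?P S - ?Q (T - {t}))) k \<in> I"
      unfolding eq coeff_add[of "_ - _"] coeff_smult using insert.prems(5)
      by (intro add_I) (simp_all only: mult.commute)
  qed
  moreover have "card S = card (T - {t})"
    using insert t by simp
  ultimately obtain \<sigma> where \<sigma>: "bij_betw \<sigma> S (T - {t})" "\<forall>i\<in>S. x i - y (\<sigma> i) \<in> I"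
    using insert.IH[of "T - {t}"] insert.prems by auto
  have "bij_betw (\<sigma>(s := t)) S (T - {t})"
    using \<sigma>(1) insert.hyps by (subst bij_betw_cong[where g = \<sigma>]) auto
  then have "bij_betw (\<sigma>(s := t)) (S \<union> {s}) (T - {t} \<union> {t})"
    using insert.hyps by (intro bij_betw_combine) auto
  then have "bij_betw (\<sigma>(s := t)) (insert s S) T"
    using t by (simp add: insert_absorb)
  moreover have "\<forall>i\<in>insert s S. x i - y ((\<sigma>(s := t)) i) \<in> I"
    using \<sigma>(2) t insert.hyps by auto
  ultimately show ?case by blast
qed

end

section \<open>Subrings of the complex numbers\<close>

lemma integer_ring_simps:
  "carrier (integer_ring \<zeta>) = {x \<in> simple_extension \<zeta>. algebraic_int x}"
  "a \<otimes>\<^bsub>integer_ring \<zeta>\<^esub> b = a * b" "a \<oplus>\<^bsub>integer_ring \<zeta>\<^esub> b = a + b"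
  "\<one>\<^bsub>integer_ring \<zeta>\<^esub> = 1" "\<zero>\<^bsub>integer_ring \<zeta>\<^esub> = 0"
  by (simp_all add: integer_ring_def ring_of_type_algebra_def)

lemma divides_integer_ring_iff:
  "a divides\<^bsub>integer_ring \<zeta>\<^esub> b \<longleftrightarrow> (\<exists>c\<in>carrier (integer_ring \<zeta>). b = a * c)"
  by (simp add: factor_def integer_ring_simps(2))

text \<open>Closure comes from the ring axioms in the domain hypothesis, once the abstract additive
  inverse is identified with complex negation.\<close>

lemma diff_closed_integer_ring:
  assumes "domain (integer_ring \<zeta>)" "a \<in> carrier (integer_ring \<zeta>)" "b \<in> carrier (integer_ring \<zeta>)"
  shows "a - b \<in> carrier (integer_ring \<zeta>)"
proof -
  interpret O: domain "integer_ring \<zeta>" by (rule assms)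
  have "b + (\<ominus>\<^bsub>integer_ring \<zeta>\<^esub> b) = 0"
    using O.r_neg[OF assms(3)] by (simp add: integer_ring_simps)
  then have "\<ominus>\<^bsub>integer_ring \<zeta>\<^esub> b = - b"
    by (simp add: eq_neg_iff_add_eq_0 add.commute)
  then show ?thesis
    using O.a_closed[OF assms(2) O.a_inv_closed[OF assms(3)]]
    by (simp only: integer_ring_simps(3)) simp
qed

lemma prime_ideal_integer_ring:
  assumes "domain (integer_ring \<zeta>)" "q \<in> carrier (integer_ring \<zeta>)"
    "ring_prime\<^bsub>integer_ring \<zeta>\<^esub> q"
  shows "prime_ideal_of_subring (carrier (integer_ring \<zeta>)) {a. q divides\<^bsub>integer_ring \<zeta>\<^esub> a}"
proof -
  interpret O: domain "integer_ring \<zeta>" by (rule assms)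
  let ?R = "carrier (integer_ring \<zeta>)"
  have prime: "prime (integer_ring \<zeta>) q" using assms by (simp add: ring_prime_def)
  show ?thesis
  proof
    show "1 \<in> ?R" using O.one_closed by (simp only: integer_ring_simps(4))
    show mult: "a * b \<in> ?R" if "a \<in> ?R" "b \<in> ?R" for a b
      using O.m_closed[OF that] by (simp only: integer_ring_simps(2))
    have add: "a + b \<in> ?R" if "a \<in> ?R" "b \<in> ?R" for a b
      using O.a_closed[OF that] by (simp only: integer_ring_simps(3))
    show "0 \<in> {a. q divides\<^bsub>integer_ring \<zeta>\<^esub> a}"
      using O.zero_closed by (force simp: divides_integer_ring_iff integer_ring_simps(5))
    show "a + b \<in> {a. q divides\<^bsub>integer_ring \<zeta>\<^esub> a}"
      if "a \<in> {a. q divides\<^bsub>integer_ring \<zeta>\<^esub> a}" "b \<in> {a. q divides\<^bsub>integer_ring \<zeta>\<^esub> a}" for a b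
      using that by (auto simp: divides_integer_ring_iff simp flip: distrib_left intro!: bexI add)
    show "a * b \<in> {a. q divides\<^bsub>integer_ring \<zeta>\<^esub> a}"
      if "a \<in> ?R" "b \<in> {a. q divides\<^bsub>integer_ring \<zeta>\<^esub> a}" for a b
      using that by (force simp: divides_integer_ring_iff mult.left_commute intro!: mult)
    \<comment> \<open>A divisor of \<open>1\<close> is a unit, which a prime is not.\<close>
    show "1 \<notin> {a. q divides\<^bsub>integer_ring \<zeta>\<^esub> a}"
      using prime O.Unit_eq_dividesone[OF assms(2)]
      by (simp add: prime_def integer_ring_simps(4))
    show "a \<in> {a. q divides\<^bsub>integer_ring \<zeta>\<^esub> a} \<or> b \<in> {a. q divides\<^bsub>integer_ring \<zeta>\<^esub> a}"
      if "a \<in> ?R" "b \<in> ?R" "a * b \<in> {a. q divides\<^bsub>integer_ring \<zeta>\<^esub> a}" for a b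
      using prime that by (auto simp: prime_def integer_ring_simps(2))
  qed (use diff_closed_integer_ring[OF assms(1)] in auto)
qed

text \<open>Evaluation at \<open>z = 0\<close> gives the constant as a difference of two products of
  negated ring elements.\<close>

lemma solution_constant_closed:
  assumes "domain (integer_ring \<zeta>)" "ideal_pte_solution (integer_ring \<zeta>) n A B"
  shows "solution_constant A B \<in> carrier (integer_ring \<zeta>)"
proof -
  interpret O: domain "integer_ring \<zeta>" by (rule assms)
  let ?R = "carrier (integer_ring \<zeta>)"
  have prod: "(\<Prod>x\<in>#C. - x) \<in> ?R" if "set_mset C \<subseteq> ?R" for C
    using that
  proof (induction C)
    case empty
    then show ?case using O.one_closed by (simp only: integer_ring_simps(4)) simp
  next
    case (add c C)
    then have "0 - c \<in> ?R"
      using O.zero_closed by (intro diff_closed_integer_ring[OF assms(1)])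
        (auto simp only: integer_ring_simps(5) set_mset_add_mset_insert)
    then show ?case
      using O.m_closed[of "0 - c" "\<Prod>x\<in>#C. - x"] add
      by (simp only: integer_ring_simps(2)) simp
  qed
  have poly: "poly (\<Prod>x\<in>#C. [:- x, 1:]) 0 = (\<Prod>x\<in>#C. - x)" for C :: "complex multiset"
    by (induction C) simp_all
  have "solution_constant A B = (\<Prod>x\<in>#A. - x) - (\<Prod>y\<in>#B. - y)"
    using arg_cong[OF pte_solution_constant(1)[OF assms(2)], of "\<lambda>p. poly p 0"] by (simp add: poly)
  also have "\<dots> \<in> ?R"
    using assms(2) by (intro diff_closed_integer_ring[OF assms(1)] prod)
      (simp_all add: ideal_pte_solution_def pte_solution_def)
  finally show ?thesis .
qed

section \<open>Congruence modulo a prime divisor of the PTE constant\<close>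

theorem theorem3p1:
  fixes \<zeta> q :: complex and n :: nat and x y :: "nat \<Rightarrow> complex"
  assumes "algebraic_int \<zeta>"
    and "factorial_domain (integer_ring \<zeta>)"
    and "ideal_pte_solution (integer_ring \<zeta>) n
           (image_mset x (mset_set {1..n})) (image_mset y (mset_set {1..n}))"
    and "q \<in> carrier (integer_ring \<zeta>)"
    and "ring_prime\<^bsub>integer_ring \<zeta>\<^esub> q"
    and "q divides\<^bsub>integer_ring \<zeta>\<^esub> pte_constant (integer_ring \<zeta>) n"
  shows "\<exists>\<sigma>. \<sigma> permutes {1..n} \<and>
           (\<forall>i\<in>{1..n}. q divides\<^bsub>integer_ring \<zeta>\<^esub> (x i - y (\<sigma> i)))"
proof -
  let ?O = "integer_ring \<zeta>"
  let ?A = "image_mset x (mset_set {1..n})" and ?B = "image_mset y (mset_set {1..n})"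
  let ?S = "{solution_constant A B | A B. ideal_pte_solution ?O n A B}"
  interpret O: factorial_domain ?O by (rule assms(2))
  interpret I: prime_ideal_of_subring "carrier ?O" "{a. q divides\<^bsub>?O\<^esub> a}"
    using prime_ideal_integer_ring[OF O.domain_axioms assms(4,5)] .
  have "?S \<subseteq> carrier ?O - {\<zero>\<^bsub>?O\<^esub>}"
    using solution_constant_closed[OF O.domain_axioms] pte_solution_constant(2)
    by (auto simp only: integer_ring_simps(5))
  moreover have "solution_constant ?A ?B \<in> ?S"
    using assms(3) by blast
  ultimately have "q divides\<^bsub>?O\<^esub> solution_constant ?A ?B"
    using O.SomeGcd_divides[of ?S] assms(4,6) O.divides_trans unfolding pte_constant_def by blast
  moreover have "(\<Prod>i\<in>{1..n}. [:- x i, 1:]) - (\<Prod>i\<in>{1..n}. [:- y i, 1:]) =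
      [:solution_constant ?A ?B:]"
    using pte_solution_constant(1)[OF assms(3)]
    by (simp add: prod_unfold_prod_mset image_mset.compositionality comp_def)
  \<comment> \<open>Coefficient \<open>0\<close> is the solution constant, a multiple of
    \<open>q\<close>; all others are \<open>0\<close>.\<close>
  ultimately have "coeff ((\<Prod>i\<in>{1..n}. [:- x i, 1:]) - (\<Prod>i\<in>{1..n}. [:- y i, 1:])) k
      \<in> {a. q divides\<^bsub>?O\<^esub> a}" for k
    using I.zero_I by (simp add: coeff_pCons split: nat.split)
  moreover have "x i \<in> carrier ?O" "y i \<in> carrier ?O" if "i \<in> {1..n}" for i
    using assms(3) that by (auto simp only: ideal_pte_solution_def pte_solution_def set_image_mset
      finite_set_mset_mset_set finite_atLeastAtMost)
  ultimately obtain \<sigma> where \<sigma>: "bij_betw \<sigma> {1..n} {1..n}"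
    "\<forall>i\<in>{1..n}. q divides\<^bsub>?O\<^esub> (x i - y (\<sigma> i))"
    using I.prod_linear_matching[of "{1..n}" "{1..n}" x y] by auto
  \<comment> \<open>The matching is controlled only on \<open>{1..n}\<close>, while
    \<open>permutes\<close> demands the identity outside.\<close>
  let ?\<tau> = "\<lambda>i. if i \<in> {1..n} then \<sigma> i else i"
  have "?\<tau> permutes {1..n}"
  proof (rule bij_imp_permutes)
    show "bij_betw ?\<tau> {1..n} {1..n}"
      using \<sigma>(1) by (subst bij_betw_cong[where g = \<sigma>]) auto
  qed auto
  then show ?thesis
    using \<sigma>(2) by (intro exI[of _ ?\<tau>]) simp
qed

end
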